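(* Fix $\eta\in\{-1,1\}$. Let $X$ be a discrete random variable with probability mass function $p\in\mathcal{G}$ and let $Y$ be another discrete random variable with probability mass function $q\in\mathcal{G}$. Then ${\rm E}_q[\mathcal{T}_p^{\eta}f(Y)]=0$ for all $f\in\mathcal{F}^{\eta}(p)$ if, and only if, either ${\rm P}(Y\in S_p)=0$, or ${\rm P}(Y\in S_p)>0$ and ${\rm P}(Y\le z\mid Y\in S_p)={\rm P}(X\le z)$ for all $z\in S_p$.
   Context: $\mathcal{G}$ is the collection of probability mass functions $p:\mathbb{Z}\to[0,1]$ whose support $S_p:=\{x\in\mathbb{Z}:p(x)>0\}$ is a discrete interval $[a,b]:=\{a,a+1,\ldots,b\}$ with $a<b$, $a,b\in\mathbb{Z}\cup\{\pm\infty\}$ (infinite endpoints are not elements of the interval). Conventions: sums over empty index sets equal $0$, and $1/p(x)$ is understood to be $0$ when $x\notin S_p$. ${\rm E}_q[l(Y)]=\sum_{x\in S_q}l(x)q(x)$ for $q$-summable $l$. For $\eta\in\{-1,1\}$ and $h:\mathbb{Z}\to\mathbb{R}$, $\Delta^{\eta}h(x)=\frac{1}{\eta}\left(h(x+\eta)-h(x)\right)$. For $p\in\mathcal{G}$ with support $[a,b]$, $\mathcal{F}^{\eta}(p)$ is the collection of functions $f:\mathbb{Z}\to\mathbb{R}$ such that $\sum_{j=a}^{b}\Delta^{\eta}(f(j)p(j))=0$ (meaning that $j\mapsto\Delta^{\eta}(f(j)p(j))$ is summable over $[a,b]$ with sum $0$). For $f\in\mathcal{F}^{\eta}(p)$,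 the function $\mathcal{T}_p^{\eta}f:\mathbb{Z}\to\mathbb{R}$ is $\mathcal{T}_p^{\eta}f(x):=\frac{1}{p(x)}\Delta^{\eta}(f(x)p(x))$, where $\Delta^\eta(f(x)p(x))$ denotes $\Delta^\eta$ applied to the product function $fp$ and evaluated at $x$; in particular $\mathcal{T}_p^{\eta}f(x)=0$ for $x\notin S_p$. *)

theory Defs
  imports "HOL-Probability.Probability" "HOL-Library.Extended"
begin

(* Endpoints live in the integers extended by a least and a greatest element;
   infinite endpoints are not members of the interval. *)
definition discrete_interval :: "int extended \<Rightarrow> int extended \<Rightarrow> int set" where
  "discrete_interval a b = {x. a \<le> Fin x \<and> Fin x \<le> b}"

(* The class of mass functions p; the support S_p is set_pmf p. *)
definition interval_pmfs :: "int pmf set" where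
  "interval_pmfs = {p. \<exists>a b. a < b \<and> set_pmf p = discrete_interval a b}"

definition diff_op :: "int \<Rightarrow> (int \<Rightarrow> real) \<Rightarrow> int \<Rightarrow> real" where
  "diff_op \<eta> h x = 1 / real_of_int \<eta> * (h (x + \<eta>) - h x)"

definition stein_class :: "int \<Rightarrow> int pmf \<Rightarrow> (int \<Rightarrow> real) set" where
  "stein_class \<eta> p = {f. (diff_op \<eta> (\<lambda>j. f j * pmf p j) has_sum 0) (set_pmf p)}"

(* The convention that 1/p(x) is 0 off the support is division by zero in HOL. *)
definition stein_op :: "int \<Rightarrow> int pmf \<Rightarrow> (int \<Rightarrow> real) \<Rightarrow> int \<Rightarrow> real" where
  "stein_op \<eta> p f x = 1 / pmf p x * diff_op \<eta> (\<lambda>j. f j * pmf p j) x"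

definition pmf_summable :: "int pmf \<Rightarrow> (int \<Rightarrow> real) \<Rightarrow> bool" where
  "pmf_summable q l \<longleftrightarrow> (\<lambda>x. l x * pmf q x) summable_on set_pmf q"

(* Meaningful only for l with pmf_summable q l: infsum is 0 on non-summable families. *)
definition pmf_expect :: "int pmf \<Rightarrow> (int \<Rightarrow> real) \<Rightarrow> real" where
  "pmf_expect q l = (\<Sum>\<^sub>\<infinity>x\<in>set_pmf q. l x * pmf q x)"

end

theory Submission
  imports Defs
begin

text \<open>For \<open>f\<close> in the Stein class of \<open>p\<close>, the difference \<open>diff_op \<eta> (f p)\<close> ranges in
particular over all \<open>\<delta>\<^sub>u - \<delta>\<^sub>v\<close> with \<open>u, v\<close> in the support of \<open>p\<close>: take for \<open>f p\<close> the indicator of the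
interval between \<open>u\<close> and \<open>v\<close>. Testing against these functions shows that \<open>q / p\<close> is constant on
the support of \<open>p\<close>. Conversely, if \<open>q = c p\<close> there, the expectation is \<open>c\<close> times
the sum of \<open>diff_op \<eta> (f p)\<close>, which vanishes. The constant is \<open>P(Y \<in> S\<^sub>p)\<close>, and
proportionality amounts to equality of the conditional distribution functions.\<close>

text \<open>Moves events about \<open>X\<close> and \<open>Y\<close> from the abstract spaces to the
  mass functions, so that the rest of the argument concerns \<open>p\<close> and \<open>q\<close>
  alone.\<close>

lemma prob_distributed_pmf:
  assumes "distributed M (count_space UNIV) X (\<lambda>x. ennreal (pmf p x))"
  shows "\<P>(\<omega> in M. P (X \<omega>)) = measure p {x. P x}"
proof -
  have X: "X \<in> measurable M (count_space UNIV)"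
    using assms by (simp add: distributed_def)
  have "distr M (count_space UNIV) X = measure_pmf p"
    using distributed_distr_eq_density[OF assms] by (simp add: measure_pmf_eq_density)
  then have "measure p {x. P x} = measure (distr M (count_space UNIV) X) {x. P x}"
    by simp
  also have "\<dots> = measure M (X -` {x. P x} \<inter> space M)"
    by (rule measure_distr[OF X]) simp
  also have "X -` {x. P x} \<inter> space M = {\<omega> \<in> space M. P (X \<omega>)}"
    by auto
  finally show ?thesis by simp
qed

text \<open>Order convexity of the support: it keeps the test functions inside the support and,
  later, shows that a support point without a predecessor in the support is the least one.\<close>

lemma interval_pmfs_connected:
  assumes "p \<in> interval_pmfs" "u \<in> set_pmf p" "v \<in> set_pmf p" "u \<le> w" "w \<le> v"
  shows "w \<in> set_pmf p"
proof -
  obtain a b where S: "set_pmf p = discrete_interval a b"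
    using assms(1) by (auto simp: interval_pmfs_def)
  have "a \<le> Fin u" "Fin v \<le> b"
    using assms(2,3) by (auto simp: S discrete_interval_def)
  then have "a \<le> Fin w" "Fin w \<le> b"
    using assms(4,5) by (meson less_eq_extended.simps(1) order_trans)+
  then show ?thesis
    by (simp add: S discrete_interval_def)
qed

lemma stein_class_point_difference:
  assumes "\<eta> \<in> {-1, 1}" "p \<in> interval_pmfs"
    and "u \<in> set_pmf p" "v \<in> set_pmf p" "u < v"
  obtains f where "f \<in> stein_class \<eta> p"
    and "diff_op \<eta> (\<lambda>j. f j * pmf p j) = (\<lambda>x. of_bool (x = u) - of_bool (x = v))"
proof -
  \<comment> \<open>A forward difference sees a jump one step before a backward difference does.
    Shifting the half-open interval accordingly gives +1 at \<open>u\<close> and -1 at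
    \<open>v\<close> for both signs of \<open>\<eta>\<close>.\<close>
  define A where "A = (if \<eta> = 1 then {u<..v} else {u..<v})"
  define f where "f x = indicator A x / pmf p x" for x
  have "A \<subseteq> set_pmf p"
    using interval_pmfs_connected[OF assms(2,3,4)] by (auto simp: A_def split: if_splits)
  then have fp: "f x * pmf p x = indicator A x" for x
    by (auto simp: f_def indicator_def set_pmf_iff)
  have diff: "diff_op \<eta> (\<lambda>j. f j * pmf p j) = (\<lambda>x. of_bool (x = u) - of_bool (x = v))"
    using assms(1,5) unfolding fp by (auto simp: fun_eq_iff diff_op_def A_def indicator_def)
  have "((\<lambda>x. of_bool (x = u) - of_bool (x = v)) has_sum (0::real)) {u, v}"
    using assms(5) by (intro has_sum_finiteI) auto
  then have "((\<lambda>x. of_bool (x = u) - of_bool (x = v)) has_sum (0::real)) (set_pmf p)"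
    using assms(3,4) by (subst has_sum_cong_neutral[where T = "{u, v}"]) auto
  then have "f \<in> stein_class \<eta> p"
    by (simp add: stein_class_def diff)
  with diff show thesis by (rule that[rotated])
qed

text \<open>Both summands vanish outside the intersection of the two supports: off the support of
  \<open>p\<close> because division by zero gives 0, off that of \<open>q\<close> because
  \<open>pmf q x\<close> is 0. On the intersection they agree.\<close>

lemma stein_op_times_pmf_has_sum_iff:
  "((\<lambda>x. stein_op \<eta> p f x * pmf q x) has_sum s) (set_pmf q) \<longleftrightarrow>
   ((\<lambda>x. diff_op \<eta> (\<lambda>j. f j * pmf p j) x * (pmf q x / pmf p x)) has_sum s) (set_pmf p)"
  by (rule has_sum_cong_neutral) (auto simp: stein_op_def set_pmf_iff)

text \<open>With \<open>has_sum\<close>, summability and value become one statement, and the default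
  value 0 of \<open>infsum\<close> cannot pass for a genuine zero sum.\<close>

lemma stein_identity_iff_has_sum:
  "pmf_summable q l \<and> pmf_expect q l = 0 \<longleftrightarrow>
   ((\<lambda>x. l x * pmf q x) has_sum 0) (set_pmf q)"
  unfolding pmf_summable_def pmf_expect_def
  by (metis has_sum_infsum infsumI summable_on_def)

lemma stein_identity_iff_proportional:
  assumes "\<eta> \<in> {-1, 1}" "p \<in> interval_pmfs"
  shows "(\<forall>f\<in>stein_class \<eta> p.
            pmf_summable q (stein_op \<eta> p f) \<and> pmf_expect q (stein_op \<eta> p f) = 0) \<longleftrightarrow>
         (\<exists>c. \<forall>x\<in>set_pmf p. pmf q x = c * pmf p x)"
    (is "?L \<longleftrightarrow> ?R")
proof
  assume L: ?L
  have eq: "pmf q u / pmf p u = pmf q v / pmf p v"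
    if uv: "u \<in> set_pmf p" "v \<in> set_pmf p" "u < v" for u v
  proof -
    obtain f where f: "f \<in> stein_class \<eta> p"
      and diff: "diff_op \<eta> (\<lambda>j. f j * pmf p j) = (\<lambda>x. of_bool (x = u) - of_bool (x = v))"
      using stein_class_point_difference[OF assms uv] by metis
    have "((\<lambda>x. (of_bool (x = u) - of_bool (x = v)) * (pmf q x / pmf p x)) has_sum 0) (set_pmf p)"
      using L[unfolded stein_identity_iff_has_sum stein_op_times_pmf_has_sum_iff, rule_format, OF f]
      unfolding diff .
    \<comment> \<open>The same series has only two terms that can be nonzero, so its sum is also the
      difference of the two ratios; uniqueness of sums makes that difference 0.\<close>
    moreover have "((\<lambda>x. (of_bool (x = u) - of_bool (x = v)) * (pmf q x / pmf p x)) has_sum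
        (pmf q u / pmf p u - pmf q v / pmf p v)) {u, v}"
      using uv(3) by (intro has_sum_finiteI) auto
    then have "((\<lambda>x. (of_bool (x = u) - of_bool (x = v)) * (pmf q x / pmf p x)) has_sum
        (pmf q u / pmf p u - pmf q v / pmf p v)) (set_pmf p)"
      using uv by (subst has_sum_cong_neutral[where T = "{u, v}"]) auto
    ultimately show ?thesis
      using has_sum_unique by fastforce
  qed
  obtain u where u: "u \<in> set_pmf p"
    using set_pmf_not_empty by fast
  have "pmf q x = pmf q u / pmf p u * pmf p x" if x: "x \<in> set_pmf p" for x
  proof -
    have "pmf q x / pmf p x = pmf q u / pmf p u"
      using eq[OF u x] eq[OF x u] by (cases x u rule: linorder_cases) simp_all
    then show ?thesis
      using x by (simp add: set_pmf_iff divide_eq_eq)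
  qed
  then show ?R by blast
next
  assume ?R
  then obtain c where c: "\<And>x. x \<in> set_pmf p \<Longrightarrow> pmf q x = c * pmf p x"
    by blast
  show ?L
  proof
    fix f assume "f \<in> stein_class \<eta> p"
    then have "((\<lambda>x. diff_op \<eta> (\<lambda>j. f j * pmf p j) x * c) has_sum 0) (set_pmf p)"
      unfolding stein_class_def using has_sum_cmult_left[where a = 0 and c = c] by auto
    then have "((\<lambda>x. diff_op \<eta> (\<lambda>j. f j * pmf p j) x * (pmf q x / pmf p x)) has_sum 0) (set_pmf p)"
      by (rule has_sum_cong[THEN iffD1, rotated]) (simp add: c set_pmf_iff)
    then show "pmf_summable q (stein_op \<eta> p f) \<and> pmf_expect q (stein_op \<eta> p f) = 0"
      by (simp only: stein_identity_iff_has_sum stein_op_times_pmf_has_sum_iff)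
  qed
qed

lemma measure_pmf_proportional:
  fixes p q :: "'a pmf"
  assumes "\<And>x. x \<in> A \<Longrightarrow> pmf q x = c * pmf p x"
  shows "measure q A = c * measure p A"
proof -
  have "measure q A = infsetsum (\<lambda>x. c * pmf p x) A"
    unfolding measure_pmf_conv_infsetsum using assms by (intro infsetsum_cong) auto
  also have "\<dots> = c * measure p A"
    unfolding measure_pmf_conv_infsetsum by (rule infsetsum_cmult_right) auto
  finally show ?thesis .
qed

text \<open>Forwards, the mass at \<open>z\<close> is the jump of the distribution function there;
  backwards, masses are summed over the part of the support up to \<open>z\<close>.\<close>

lemma cdf_proportional_iff:
  fixes p q :: "int pmf"
  assumes "p \<in> interval_pmfs"
  shows "(\<forall>z\<in>set_pmf p. measure q ({..z} \<inter> set_pmf p) = c * measure p {..z}) \<longleftrightarrow>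
         (\<forall>z\<in>set_pmf p. pmf q z = c * pmf p z)"
    (is "?L \<longleftrightarrow> ?R")
proof
  assume L: ?L
  show ?R
  proof
    fix z assume z: "z \<in> set_pmf p"
    have split: "measure r ({..z} \<inter> set_pmf p) = measure r ({..z - 1} \<inter> set_pmf p) + pmf r z"
      for r :: "int pmf"
    proof -
      have "{..z} \<inter> set_pmf p = ({..z - 1} \<inter> set_pmf p) \<union> {z}"
        using z by auto
      then have "measure r ({..z} \<inter> set_pmf p) = measure r ({..z - 1} \<inter> set_pmf p) + measure r {z}"
        by (simp only:) (rule measure_pmf.finite_measure_Union, auto)
      then show ?thesis
        by (simp add: measure_pmf_single)
    qed
    have "measure q ({..z - 1} \<inter> set_pmf p) = c * measure p ({..z - 1} \<inter> set_pmf p)"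
    \<comment> \<open>The hypothesis speaks only of points of the support. If \<open>z - 1\<close>
      is not one, \<open>z\<close> is the least point and both sides are 0.\<close>
    proof (cases "z - 1 \<in> set_pmf p")
      case True
      then show ?thesis
        using L by (simp add: measure_Int_set_pmf)
    next
      case False
      then have "{..z - 1} \<inter> set_pmf p = {}"
        using interval_pmfs_connected[OF assms _ z, of _ "z - 1"] by auto
      then show ?thesis by simp
    qed
    moreover have "measure q ({..z} \<inter> set_pmf p) = c * measure p ({..z} \<inter> set_pmf p)"
      using L z by (simp add: measure_Int_set_pmf)
    ultimately show "pmf q z = c * pmf p z"
      using split[of q] split[of p] by (simp add: distrib_left)
  qed
next
  assume R: ?R
  show ?L
  proof
    fix z
    have "measure q ({..z} \<inter> set_pmf p) = c * measure p ({..z} \<inter> set_pmf p)"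
      using R by (intro measure_pmf_proportional) auto
    then show "measure q ({..z} \<inter> set_pmf p) = c * measure p {..z}"
      by (simp add: measure_Int_set_pmf)
  qed
qed

text \<open>Summing over the support of \<open>p\<close>, where \<open>p\<close> has total mass 1,
  forces the value of the constant.\<close>

lemma proportional_iff_measure_support:
  fixes p q :: "'a pmf"
  shows
  "(\<exists>c. \<forall>x\<in>set_pmf p. pmf q x = c * pmf p x) \<longleftrightarrow>
   (\<forall>x\<in>set_pmf p. pmf q x = measure q (set_pmf p) * pmf p x)"
proof -
  have "measure q (set_pmf p) = c" if "\<forall>x\<in>set_pmf p. pmf q x = c * pmf p x" for c
  proof -
    have "measure q (set_pmf p) = c * measure p (set_pmf p)"
      using that by (intro measure_pmf_proportional) auto
    also have "measure p (set_pmf p) = 1"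
      by (simp add: measure_pmf.prob_eq_1 AE_measure_pmf)
    finally show ?thesis by simp
  qed
  then show ?thesis by metis
qed

theorem theorem2p1:
  fixes \<eta> :: int
    and p q :: "int pmf"
    and M :: "'a measure" and X :: "'a \<Rightarrow> int"
    and N :: "'b measure" and Y :: "'b \<Rightarrow> int"
  assumes "\<eta> \<in> {-1, 1}"
    and "p \<in> interval_pmfs" and "q \<in> interval_pmfs"
    and "prob_space M" and "distributed M (count_space UNIV) X (\<lambda>x. ennreal (pmf p x))"
    and "prob_space N" and "distributed N (count_space UNIV) Y (\<lambda>x. ennreal (pmf q x))"
  shows "(\<forall>f\<in>stein_class \<eta> p.
            pmf_summable q (stein_op \<eta> p f) \<and> pmf_expect q (stein_op \<eta> p f) = 0) \<longleftrightarrow>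
         \<P>(\<omega> in N. Y \<omega> \<in> set_pmf p) = 0 \<or>
         (\<P>(\<omega> in N. Y \<omega> \<in> set_pmf p) > 0 \<and>
          (\<forall>z\<in>set_pmf p.
             \<P>(\<omega> in N. Y \<omega> \<le> z \<bar> Y \<omega> \<in> set_pmf p) = \<P>(\<omega> in M. X \<omega> \<le> z)))"
proof -
  define c where "c = measure q (set_pmf p)"
  have X: "\<P>(\<omega> in M. X \<omega> \<le> z) = measure p {..z}" for z
    by (simp add: prob_distributed_pmf[OF assms(5), of "\<lambda>x. x \<le> z"] atMost_def)
  have Y: "\<P>(\<omega> in N. Y \<omega> \<in> set_pmf p) = c"
    by (simp add: prob_distributed_pmf[OF assms(7), of "\<lambda>x. x \<in> set_pmf p"] c_def)
  have YS: "\<P>(\<omega> in N. Y \<omega> \<le> z \<bar> Y \<omega> \<in> set_pmf p) = measure q ({..z} \<inter> set_pmf p) / c" for z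
    unfolding cond_prob_def Y
    by (simp add: prob_distributed_pmf[OF assms(7), of "\<lambda>x. x \<le> z \<and> x \<in> set_pmf p"]
        Int_def)
  have "(\<forall>f\<in>stein_class \<eta> p.
            pmf_summable q (stein_op \<eta> p f) \<and> pmf_expect q (stein_op \<eta> p f) = 0) \<longleftrightarrow>
        (\<forall>z\<in>set_pmf p. measure q ({..z} \<inter> set_pmf p) = c * measure p {..z})"
    by (simp only: stein_identity_iff_proportional[OF assms(1,2)] proportional_iff_measure_support
        cdf_proportional_iff[OF assms(2)] c_def)
  also have "\<dots> \<longleftrightarrow> c = 0 \<or> (c > 0 \<and>
      (\<forall>z\<in>set_pmf p. measure q ({..z} \<inter> set_pmf p) / c = measure p {..z}))"
  \<comment> \<open>For \<open>c = 0\<close> monotonicity makes every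
    \<open>measure q ({..z} \<inter> set_pmf p)\<close> zero, so both sides hold; otherwise one
    divides by \<open>c\<close>.\<close>
  proof (cases "c = 0")
    case True
    have "measure q ({..z} \<inter> set_pmf p) \<le> c" for z
      unfolding c_def by (rule measure_pmf.finite_measure_mono) auto
    then show ?thesis
      using True by (auto intro!: antisym)
  next
    case False
    then have "c > 0"
      by (simp add: c_def zero_less_measure_iff)
    then show ?thesis
      by (simp add: divide_eq_eq mult.commute)
  qed
  finally show ?thesis
    by (simp only: X Y YS)
qed

end
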